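(* Let $\mu_1,\dots,\mu_n \in \mathcal{P}(\mathbb{R})$ and let $\lambda_1>0,\dots,\lambda_n>0$. Suppose $\sum_{i=1}^n \lambda_i J(\mu_i,\nu) < +\infty$ for some $\nu\in\mathcal{P}(\mathbb{R})$. Then the Fréchet barycenter $\operatorname{bar}(\mu_i,\lambda_i)_{1\le i\le n}$ exists and is unique, and it is given by $\nu^* = \psi_\#\mathcal{L}|_{(0,1)}$, where for $0<x<1$ $$\psi(x) := \arg\min_{y\in\mathbb{R}} \sum_{i=1}^n \lambda_i\, g\bigl(F^{-1}_{\mu_i}(x) - y\bigr).$$
   Context: $g\colon\mathbb{R}\to\mathbb{R}$ is a strictly convex function that attains its minimum at $0$, with $g(0)=0$. $\mathcal{P}(\mathbb{R})$ is the set of Borel probability measures on $\mathbb{R}$. For $\mu\in\mathcal{P}(\mathbb{R})$, $F_\mu(x)=\mu((-\infty,x))$ and the quantile function is $F_\mu^{-1}(y)=\inf\{x\colon F_\mu(x)\ge y\}$ for $0<y<1$. The transportation cost is $$J(\mu,\nu) := \inf_{\gamma\in\Pi(\mu,\nu)}\int_{\mathbb{R}\times\mathbb{R}} g(x-y)\,d\gamma(x,y) = \int_0^1 g\bigl(F_\mu^{-1}(x)-F_\nu^{-1}(x)\bigr)\,dx\in[0,+\infty],$$ where $\Pi(\mu,\nu)$ is the set of probability measures on $\mathbb{R}^2$ with first marginal $\mu$ and second marginal $\nu$. The Fréchet barycenter $\operatorname{bar}(\mu_i,\lambda_i)_{1\le i\le n}$ is a measure minimizing $\nu\mapsto\sum_{i=1}^n\lambda_i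 J(\mu_i,\nu)$ over $\nu\in\mathcal{P}(\mathbb{R})$. $\mathcal{L}|_{(0,1)}$ is Lebesgue measure on $(0,1)$ and $\psi_\#$ denotes push-forward of measures. *)

theory Defs
  imports "HOL-Probability.Probability"
begin

definition strictly_convex_on :: "real set \<Rightarrow> (real \<Rightarrow> real) \<Rightarrow> bool" where
  "strictly_convex_on S g \<longleftrightarrow> convex S \<and>
     (\<forall>x\<in>S. \<forall>y\<in>S. \<forall>t. x \<noteq> y \<longrightarrow> 0 < t \<longrightarrow> t < 1 \<longrightarrow>
        g ((1 - t) * x + t * y) < (1 - t) * g x + t * g y)"

text \<open>The distribution function used here is left-continuous, \<open>F(x) = M((-\<infinity>, x))\<close>, so it
  differs from the library's right-continuous \<^const>\<open>cdf\<close>.\<close>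

definition left_cdf :: "real measure \<Rightarrow> real \<Rightarrow> real" where
  "left_cdf M x = measure M {..<x}"

text \<open>Only meaningful for \<open>0 < y < 1\<close>; elsewhere the infimum may be that of an empty or
  unbounded set.\<close>

definition quantile :: "real measure \<Rightarrow> real \<Rightarrow> real" where
  "quantile M y = Inf {x. y \<le> left_cdf M x}"

definition couplings :: "real measure \<Rightarrow> real measure \<Rightarrow> (real \<times> real) measure set" where
  "couplings M N = {\<gamma>. prob_space \<gamma> \<and> sets \<gamma> = sets borel \<and>
     distr \<gamma> borel fst = M \<and> distr \<gamma> borel snd = N}"

text \<open>The cost function \<open>g\<close> is meant to be nonnegative: \<^const>\<open>ennreal\<close> truncates negative
  values to \<open>0\<close>.\<close>

definition transport_cost :: "(real \<Rightarrow> real) \<Rightarrow> real measure \<Rightarrow> real measure \<Rightarrow> ennreal" where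
  "transport_cost g M N =
     (INF \<gamma>\<in>couplings M N. \<integral>\<^sup>+ (x, y). ennreal (g (x - y)) \<partial>\<gamma>)"

definition frechet_functional ::
  "(real \<Rightarrow> real) \<Rightarrow> nat \<Rightarrow> (nat \<Rightarrow> real measure) \<Rightarrow> (nat \<Rightarrow> real) \<Rightarrow> real measure \<Rightarrow> ennreal" where
  "frechet_functional g n \<mu> w \<nu> = (\<Sum>i=1..n. ennreal (w i) * transport_cost g (\<mu> i) \<nu>)"

text \<open>\<^const>\<open>real_distribution\<close> is the predicate of being a Borel probability measure on the
  real line.\<close>

definition is_frechet_barycenter ::
  "(real \<Rightarrow> real) \<Rightarrow> nat \<Rightarrow> (nat \<Rightarrow> real measure) \<Rightarrow> (nat \<Rightarrow> real) \<Rightarrow> real measure \<Rightarrow> bool" where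
  "is_frechet_barycenter g n \<mu> w \<nu> \<longleftrightarrow>
     is_arg_min (frechet_functional g n \<mu> w) real_distribution \<nu>"

definition quantile_cost ::
  "(real \<Rightarrow> real) \<Rightarrow> nat \<Rightarrow> (nat \<Rightarrow> real measure) \<Rightarrow> (nat \<Rightarrow> real) \<Rightarrow> real \<Rightarrow> real \<Rightarrow> real" where
  "quantile_cost g n \<mu> w x y = (\<Sum>i=1..n. w i * g (quantile (\<mu> i) x - y))"

text \<open>\<^const>\<open>arg_min\<close> picks an arbitrary minimizer, so this is the intended function only
  where the minimizer exists and is unique.\<close>

definition quantile_argmin ::
  "(real \<Rightarrow> real) \<Rightarrow> nat \<Rightarrow> (nat \<Rightarrow> real measure) \<Rightarrow> (nat \<Rightarrow> real) \<Rightarrow> real \<Rightarrow> real" where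
  "quantile_argmin g n \<mu> w x = (ARG_MIN (quantile_cost g n \<mu> w x) y. True)"

end

theory Submission
  imports Defs
begin

text \<open>
  Pushing Lebesgue measure on \<open>(0,1)\<close> forward by the pair of quantile functions of two measures
  gives a coupling of them, and in dimension one this comonotone coupling is optimal. Hence the
  functional to be minimized is \<open>\<nu> \<mapsto> \<integral> \<Phi>\<^sub>u(Q\<^sub>\<nu>(u)) du\<close>, where \<open>Q\<^sub>\<nu>\<close> is the quantile function of
  \<open>\<nu>\<close> and \<open>\<Phi>\<^sub>u(y) = \<Sum>\<^sub>i w\<^sub>i g(Q\<^sub>i(u) - y)\<close>, and the integrand can be minimized separately for
  every \<open>u\<close>. Each \<open>\<Phi>\<^sub>u\<close> is strictly convex and coercive, so it has a unique minimizer \<open>\<psi>(u)\<close>.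
  Convexity of \<open>g\<close> and monotonicity of the \<open>Q\<^sub>i\<close> make \<open>\<psi>\<close> nondecreasing, hence measurable.

  The two halves of the optimality statement enter separately. An arbitrary competitor \<open>\<nu>\<close> satisfies
  \<open>J(\<mu>\<^sub>i, \<nu>) \<ge> \<integral> g(Q\<^sub>i - Q\<^sub>\<nu>)\<close> (\<open>transport_cost_ge_quantile_integral\<close>). For the image \<open>\<nu>\<^sup>*\<close> of
  Lebesgue measure under \<open>\<psi>\<close>, the maps \<open>(Q\<^sub>i, \<psi>)\<close> define couplings which show
  \<open>J(\<mu>\<^sub>i, \<nu>\<^sup>*) \<le> \<integral> g(Q\<^sub>i - \<psi>)\<close> (\<open>transport_cost_le_integral\<close>). Together they give
  \<open>F(\<nu>\<^sup>*) \<le> \<integral> min \<Phi>\<^sub>u du \<le> \<integral> \<Phi>\<^sub>u(Q\<^sub>\<nu>(u)) du \<le> F(\<nu>)\<close> for the functional \<open>F\<close>. If \<open>\<nu>\<close> is also a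
  minimizer, all these terms agree; as they are finite, \<open>Q\<^sub>\<nu> = \<psi>\<close> almost everywhere, so that
  \<open>\<nu> = \<nu>\<^sup>*\<close> because a measure is the image of Lebesgue measure under its quantile function.

  The lower bound for a general coupling rests on a layer decomposition
  (\<open>nn_integral_subgradient_reflect\<close>, \<open>nn_integral_layers\<close>): since \<open>g\<close> is the integral of a
  nondecreasing subgradient \<open>h\<close>, the cost \<open>g(x - y)\<close> of a pair with \<open>y < x\<close> is the area of the set of
  \<open>(s, r)\<close> with \<open>r \<ge> 0\<close>, \<open>y < s < x\<close> and \<open>r < h(x - s)\<close>. For fixed \<open>(s, r)\<close> this is the condition
  that \<open>y\<close> lies in a lower set and \<open>x\<close> in an upper set, and among all couplings with given marginals
  the comonotone one gives such a product of sets the least mass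
  (\<open>comonotone_minimizes_quadrant\<close>). Pairs with \<open>x < y\<close> are treated by reflection.
\<close>

section \<open>Convex functions on the line\<close>

lemma strictly_convex_imp_convex_on:
  assumes "strictly_convex_on S g"
  shows "convex_on S g"
proof (intro convex_onI)
  show "convex S" using assms by (simp add: strictly_convex_on_def)
  fix t x y :: real
  assume "0 < t" "t < 1" "x \<in> S" "y \<in> S"
  then show "g ((1 - t) *\<^sub>R x + t *\<^sub>R y) \<le> (1 - t) * g x + t * g y"
    using assms by (cases "x = y") (auto simp: strictly_convex_on_def intro!: less_imp_le simp flip: distrib_right)
qed

lemma convex_subgradient:
  fixes g :: "real \<Rightarrow> real"
  assumes "convex_on UNIV g"
  obtains h where "\<And>x y. g x + h x * (y - x) \<le> g y"
  using convex_le_Inf_differential[OF assms] by force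

lemma subgradient_mono:
  fixes g h :: "real \<Rightarrow> real"
  assumes h: "\<And>x y. g x + h x * (y - x) \<le> g y"
  shows "mono h"
proof (rule monoI)
  fix x y :: real assume "x \<le> y"
  have "0 \<le> (h y - h x) * (y - x)"
    using h[of x y] h[of y x] by (simp add: algebra_simps)
  then show "h x \<le> h y"
    using \<open>x \<le> y\<close> by (cases "x = y") (auto simp: zero_le_mult_iff)
qed

text \<open>
  Cutting \<open>[a,b]\<close> into \<open>n\<close> equal pieces and telescoping bounds the increment of \<open>D\<close> by
  \<open>(b - a) (h b - h a) / n\<close> for every \<open>n\<close>.
\<close>

lemma constant_of_increment_bound:
  fixes D h :: "real \<Rightarrow> real"
  assumes "a \<le> b"
    and D: "\<And>x y. a \<le> x \<Longrightarrow> x \<le> y \<Longrightarrow> y \<le> b \<Longrightarrow> \<bar>D y - D x\<bar> \<le> (h y - h x) * (y - x)"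
  shows "D b = D a"
proof -
  have bound: "\<bar>D b - D a\<bar> * real n \<le> (b - a) * (h b - h a)" if "0 < n" for n :: nat
  proof -
    define p where "p k = a + real k * ((b - a) / n)" for k
    have p: "p 0 = a" "p n = b"
      using that by (auto simp: p_def)
    have step: "p (Suc k) - p k = (b - a) / n" for k
      by (simp add: p_def distrib_right add_divide_distrib)
    have pmono: "p k \<le> p j" if "k \<le> j" for k j
      unfolding p_def using that \<open>a \<le> b\<close> by (intro add_left_mono mult_right_mono) auto
    have "\<bar>D b - D a\<bar> = \<bar>\<Sum>k<n. D (p (Suc k)) - D (p k)\<bar>"
      using sum_lessThan_telescope[of "\<lambda>k. D (p k)" n] p by simp
    also have "\<dots> \<le> (\<Sum>k<n. \<bar>D (p (Suc k)) - D (p k)\<bar>)"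
      by (rule sum_abs)
    also have "\<dots> \<le> (\<Sum>k<n. (h (p (Suc k)) - h (p k)) * ((b - a) / n))"
    proof (rule sum_mono)
      fix k assume "k \<in> {..<n}"
      then have "a \<le> p k" "p k \<le> p (Suc k)" "p (Suc k) \<le> b"
        using pmono[of 0 k] pmono[of k "Suc k"] pmono[of "Suc k" n] p by auto
      from D[OF this] show "\<bar>D (p (Suc k)) - D (p k)\<bar> \<le> (h (p (Suc k)) - h (p k)) * ((b - a) / n)"
        by (simp only: step)
    qed
    also have "\<dots> = (h b - h a) * ((b - a) / n)"
      using sum_lessThan_telescope[of "\<lambda>k. h (p k)" n] p
      unfolding sum_distrib_right[symmetric] by simp
    finally show ?thesis
      using that by (simp add: field_simps)
  qed
  show ?thesis
  proof (rule ccontr)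
    assume "D b \<noteq> D a"
    then obtain n :: nat where "(b - a) * (h b - h a) < real n * \<bar>D b - D a\<bar>"
      using reals_Archimedean3[of "\<bar>D b - D a\<bar>"] by auto
    moreover from this D[of a b] \<open>a \<le> b\<close> have "0 < n"
      by (cases n) (auto simp: mult.commute)
    ultimately show False
      using bound[of n] by (simp add: mult.commute)
  qed
qed

text \<open>
  The defect \<open>g z - \<integral>\<^sub>a\<^sup>z h\<close> is constant: on \<open>[x,y]\<close> the increment of \<open>g\<close> and the integral of \<open>h\<close>
  both lie between \<open>h x (y - x)\<close> and \<open>h y (y - x)\<close>.
\<close>

lemma subgradient_has_integral:
  fixes g h :: "real \<Rightarrow> real"
  assumes h: "\<And>x y. g x + h x * (y - x) \<le> g y"
    and "a \<le> b"
  shows "(h has_integral (g b - g a)) {a..b}"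
proof -
  note mono = subgradient_mono[OF h]
  have int: "h integrable_on {x..y}" for x y
    by (intro integrable_on_mono_on monotone_on_subset[OF mono]) auto
  define D where "D z = g z - integral {a..z} h" for z
  have "D b = D a"
  proof (rule constant_of_increment_bound[OF \<open>a \<le> b\<close>, where h = h])
    fix x y assume xy: "a \<le> x" "x \<le> y" "y \<le> b"
    have "integral {a..y} h = integral {a..x} h + integral {x..y} h"
      using Henstock_Kurzweil_Integration.integral_combine[OF xy(1,2) int] by simp
    moreover have "h x * (y - x) \<le> integral {x..y} h"
      using integral_le[of "\<lambda>_. h x" "{x..y}" h] int monoD[OF mono] xy by (auto simp: mult.commute)
    moreover have "integral {x..y} h \<le> h y * (y - x)"
      using integral_le[of h "{x..y}" "\<lambda>_. h y"] int monoD[OF mono] xy by (auto simp: mult.commute)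
    ultimately show "\<bar>D y - D x\<bar> \<le> (h y - h x) * (y - x)"
      using h[of x y] h[of y x] unfolding D_def abs_le_iff by (simp add: algebra_simps)
  qed
  then show ?thesis
    using integrable_integral[OF int[of a b]] by (simp add: D_def algebra_simps)
qed

lemma strictly_convex_unique_minimizer:
  assumes f: "strictly_convex_on UNIV f"
    and "is_arg_min f (\<lambda>_. True) x" "is_arg_min f (\<lambda>_. True) y"
  shows "x = y"
proof (rule ccontr)
  assume "x \<noteq> y"
  \<comment> \<open>strict convexity at the midpoint\<close>
  moreover have "(0::real) < 1/2" "(1/2::real) < 1" by simp_all
  ultimately obtain m where m: "f m < (1 - 1/2) * f x + 1/2 * f y"
    using f unfolding strictly_convex_on_def by blast
  have "f x \<le> f m" "f y \<le> f m"
    using assms(2,3) unfolding is_arg_min_linorder by blast+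
  with m show False by simp
qed

text \<open>
  A strictly convex function is positive away from its minimum, and the chord from \<open>0\<close> to \<open>z\<close>
  lies above the graph at \<open>\<plusminus>1\<close>. This is the coercivity behind the existence of minimizers.
\<close>

lemma strictly_convex_linear_growth:
  fixes g :: "real \<Rightarrow> real"
  assumes g: "strictly_convex_on UNIV g" "\<And>x. g 0 \<le> g x" "g 0 = 0"
  obtains c where "0 < c" "\<And>z. 1 \<le> \<bar>z\<bar> \<Longrightarrow> c * \<bar>z\<bar> \<le> g z"
proof
  have pos: "0 < g z" if "z \<noteq> 0" for z
  proof (rule ccontr)
    assume "\<not> 0 < g z"
    then have "is_arg_min g (\<lambda>_. True) z" "is_arg_min g (\<lambda>_. True) 0"
      using g(2) g(3) by (auto simp: is_arg_min_linorder intro: order_trans[of _ 0])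
    from strictly_convex_unique_minimizer[OF g(1) this] that show False by simp
  qed
  then show "0 < min (g 1) (g (- 1))"
    by simp
  fix z :: real assume z: "1 \<le> \<bar>z\<bar>"
  have "(1 - 1 / \<bar>z\<bar>) *\<^sub>R 0 + (1 / \<bar>z\<bar>) *\<^sub>R z = sgn z"
    using z by (simp add: sgn_real_def abs_if)
  moreover have "0 \<le> 1 / \<bar>z\<bar>" "1 / \<bar>z\<bar> \<le> 1"
    using z by simp_all
  ultimately have "g (sgn z) \<le> (1 / \<bar>z\<bar>) * g z"
    using convex_onD[OF strictly_convex_imp_convex_on[OF g(1)], of "1 / \<bar>z\<bar>" 0 z] g(3) by simp
  moreover have "min (g 1) (g (- 1)) \<le> g (sgn z)"
    using z by (auto simp: sgn_real_def)
  ultimately have "min (g 1) (g (- 1)) \<le> (1 / \<bar>z\<bar>) * g z" by linarith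
  then show "min (g 1) (g (- 1)) * \<bar>z\<bar> \<le> g z"
    using z by (simp add: field_simps)
qed

text \<open>
  Both \<open>a + s\<close> and \<open>b\<close> lie between \<open>a\<close> and \<open>b + s\<close>, with complementary convex weights, so the two
  convexity inequalities add up to the claim.
\<close>

lemma convex_increment_mono:
  fixes g :: "real \<Rightarrow> real"
  assumes g: "convex_on UNIV g" and "a \<le> b" "0 \<le> s"
  shows "g (a + s) - g a \<le> g (b + s) - g b"
proof (cases "b - a + s = 0")
  case True
  then have "a = b" "s = 0" using assms(2,3) by linarith+
  then show ?thesis by simp
next
  case False
  \<comment> \<open>\<open>a + s\<close> divides the segment from \<open>a\<close> to \<open>b + s\<close> in the ratio \<open>t : 1 - t\<close>\<close>
  define t where "t = s / (b - a + s)"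
  have t: "0 \<le> t" "t \<le> 1" "t * (b - a + s) = s"
    using assms False by (auto simp: t_def divide_le_eq_1)
  have "(1 - t) * a + t * (b + s) = a + s" "(1 - (1 - t)) * a + (1 - t) * (b + s) = b"
    using t(3) by (auto simp: algebra_simps)
  then have "g (a + s) \<le> (1 - t) * g a + t * g (b + s)" "g b \<le> t * g a + (1 - t) * g (b + s)"
    using convex_onD[OF g, of t a "b + s"] convex_onD[OF g, of "1 - t" a "b + s"] t by auto
  then show ?thesis by (simp add: algebra_simps)
qed

section \<open>Convex costs as superpositions of quadrants\<close>

text \<open>
  The map \<open>s \<mapsto> g (x - s)\<close> has the subgradient \<open>s \<mapsto> - h (x - s)\<close>, which \<open>subgradient_has_integral\<close>
  integrates from \<open>y\<close> to \<open>x\<close>. Taking the positive part of \<open>x - y\<close> keeps only the half of the cost for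
  which \<open>s\<close> runs upwards from \<open>y\<close> to \<open>x\<close>, and makes both sides vanish for \<open>x \<le> y\<close>.
\<close>

lemma nn_integral_subgradient_reflect:
  fixes g h :: "real \<Rightarrow> real"
  assumes h: "\<And>x y. g x + h x * (y - x) \<le> g y"
    and g: "\<And>x. g 0 \<le> g x" "g 0 = 0"
  shows "(\<integral>\<^sup>+ s. ennreal (h (x - s)) * indicator {y<..<x} s \<partial>lborel) = ennreal (g (max 0 (x - y)))"
proof (cases "y < x")
  case True
  have [measurable]: "h \<in> borel_measurable borel"
    by (intro borel_measurable_mono subgradient_mono[OF h])
  have pos: "0 \<le> h z" if "0 < z" for z
  proof -
    have "0 \<le> h z * z"
      using h[of z 0] g(1)[of z] by simp
    then show ?thesis
      using that by (simp add: zero_le_mult_iff)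
  qed
  have "((\<lambda>s. - h (x - s)) has_integral (g (x - x) - g (x - y))) {y..x}"
  proof (rule subgradient_has_integral)
    show "g (x - a) + - h (x - a) * (b - a) \<le> g (x - b)" for a b
      using h[of "x - a" "x - b"] by (simp add: algebra_simps)
  qed (use True in simp)
  from has_integral_neg[OF this]
  \<comment> \<open>the end point \<open>s = x\<close> is left out because the subgradient \<open>h 0\<close> at the minimum may be negative\<close>
  have "((\<lambda>s. h (x - s)) has_integral g (x - y)) {y<..<x}"
    using g(2) by (simp add: has_integral_Icc_iff_Ioo)
  then have "((\<lambda>s. if s \<in> {y<..<x} then h (x - s) else 0) has_integral g (x - y)) UNIV"
    by (simp only: has_integral_restrict_UNIV)
  also have "(\<lambda>s. if s \<in> {y<..<x} then h (x - s) else 0) = (\<lambda>s. indicator {y<..<x} s * h (x - s))"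
    by (auto simp: indicator_def)
  finally have "((\<lambda>s. indicator {y<..<x} s * h (x - s)) has_integral g (x - y)) UNIV" .
  then have "(\<integral>\<^sup>+ s. ennreal (indicator {y<..<x} s * h (x - s)) \<partial>lborel) = ennreal (g (x - y))"
    using pos by (intro nn_integral_has_integral_lborel) (auto simp: indicator_def)
  then show ?thesis
    using True by (auto simp: indicator_def intro!: nn_integral_cong elim!: back_subst[of "\<lambda>a. a = _"])
qed (simp add: g)

text \<open>
  Writing \<open>h (x - s)\<close> as the length of \<open>[0, h (x - s))\<close> turns the cost into an area of points
  \<open>\<theta> = (s, r)\<close>, and Tonelli's theorem exchanges this area with the integral over \<open>\<gamma>\<close>. On the right
  \<open>\<gamma>\<close> enters only through its values on intersections of a set \<open>{y < s}\<close> with a set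
  \<open>{x \<in> U}\<close>, where \<open>U\<close> is an upper set because \<open>h\<close> is nondecreasing.
\<close>

lemma nn_integral_layers:
  fixes g h :: "real \<Rightarrow> real"
  assumes h: "\<And>x y. g x + h x * (y - x) \<le> g y"
    and g: "\<And>x. g 0 \<le> g x" "g 0 = 0"
    and \<gamma>: "prob_space \<gamma>" "sets \<gamma> = sets borel"
  shows "(\<integral>\<^sup>+ p. ennreal (g (max 0 (fst p - snd p))) \<partial>\<gamma>) =
    (\<integral>\<^sup>+ \<theta>. emeasure \<gamma> ({p. snd p < fst \<theta>} \<inter> {p. fst \<theta> < fst p \<and> snd \<theta> < h (fst p - fst \<theta>)})
       * indicator {0..} (snd \<theta>) \<partial>(lborel \<Otimes>\<^sub>M lborel))"
proof -
  have [measurable]: "h \<in> borel_measurable borel"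
    by (intro borel_measurable_mono subgradient_mono[OF h])
  have [measurable_cong]: "sets \<gamma> = sets (borel \<Otimes>\<^sub>M borel)"
    using \<gamma>(2) by (simp only: borel_prod)
  interpret G: prob_space \<gamma> by fact
  interpret P: pair_sigma_finite \<gamma> "lborel \<Otimes>\<^sub>M lborel :: (real \<times> real) measure"
    by (intro pair_sigma_finite.intro G.sigma_finite_measure_axioms)
       (simp add: lborel_prod lborel.sigma_finite_measure_axioms)
  \<comment> \<open>\<open>L\<close> indicates that \<open>\<theta> = (s, r)\<close> lies in the region of area \<open>g (x - y)\<close> belonging to \<open>p = (x, y)\<close>\<close>
  define L where "L p \<theta> = (indicator ({p. snd p < fst \<theta>} \<inter>
     {p. fst \<theta> < fst p \<and> snd \<theta> < h (fst p - fst \<theta>)}) p * indicator {0..} (snd \<theta>) :: ennreal)"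
    for p \<theta> :: "real \<times> real"
  have [measurable]: "(\<lambda>(p, \<theta>). L p \<theta>) \<in> borel_measurable (\<gamma> \<Otimes>\<^sub>M (lborel \<Otimes>\<^sub>M lborel))"
    unfolding L_def indicator_def by measurable
  have "ennreal (g (max 0 (fst p - snd p))) = (\<integral>\<^sup>+ \<theta>. L p \<theta> \<partial>(lborel \<Otimes>\<^sub>M lborel))"
    if "p \<in> space \<gamma>" for p
  proof -
    have [measurable]: "L p \<in> borel_measurable (lborel \<Otimes>\<^sub>M lborel)"
      unfolding L_def indicator_def by measurable
    have "(\<integral>\<^sup>+ r. L p (s, r) \<partial>lborel) = ennreal (h (fst p - s)) * indicator {snd p<..<fst p} s" for s
    proof -
      have "(\<integral>\<^sup>+ r. L p (s, r) \<partial>lborel) =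
          (\<integral>\<^sup>+ r. indicator {0..<h (fst p - s)} r * indicator {snd p<..<fst p} s \<partial>lborel)"
        by (intro nn_integral_cong) (auto simp: L_def indicator_def)
      also have "\<dots> = emeasure lborel {0..<h (fst p - s)} * indicator {snd p<..<fst p} s"
        by (simp add: nn_integral_multc)
      also have "emeasure lborel {0..<h (fst p - s)} = ennreal (h (fst p - s))"
        by (cases "0 \<le> h (fst p - s)") (auto simp: ennreal_neg)
      finally show ?thesis .
    qed
    then show ?thesis
      by (subst lborel.nn_integral_fst[symmetric])
         (simp_all add: nn_integral_subgradient_reflect[OF h g])
  qed
  then have "(\<integral>\<^sup>+ p. ennreal (g (max 0 (fst p - snd p))) \<partial>\<gamma>) =
      (\<integral>\<^sup>+ p. (\<integral>\<^sup>+ \<theta>. L p \<theta> \<partial>(lborel \<Otimes>\<^sub>M lborel)) \<partial>\<gamma>)"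
    by (rule nn_integral_cong)
  also have "\<dots> = (\<integral>\<^sup>+ \<theta>. (\<integral>\<^sup>+ p. L p \<theta> \<partial>\<gamma>) \<partial>(lborel \<Otimes>\<^sub>M lborel))"
    by (rule P.Fubini'[symmetric]) measurable
  also have "\<dots> = (\<integral>\<^sup>+ \<theta>. emeasure \<gamma> ({p. snd p < fst \<theta>} \<inter>
       {p. fst \<theta> < fst p \<and> snd \<theta> < h (fst p - fst \<theta>)}) * indicator {0..} (snd \<theta>)
       \<partial>(lborel \<Otimes>\<^sub>M lborel))"
  proof (intro nn_integral_cong)
    fix \<theta> :: "real \<times> real"
    have "{p \<in> space \<gamma>. snd p < fst \<theta> \<and> fst \<theta> < fst p \<and> snd \<theta> < h (fst p - fst \<theta>)} \<in> sets \<gamma>"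
      by measurable
    moreover have "space \<gamma> = UNIV"
      using sets_eq_imp_space_eq[OF \<gamma>(2)] by simp
    ultimately have "{p. snd p < fst \<theta>} \<inter> {p. fst \<theta> < fst p \<and> snd \<theta> < h (fst p - fst \<theta>)} \<in> sets \<gamma>"
      by (simp add: Int_def)
    then show "(\<integral>\<^sup>+ p. L p \<theta> \<partial>\<gamma>) = emeasure \<gamma> ({p. snd p < fst \<theta>} \<inter>
       {p. fst \<theta> < fst p \<and> snd \<theta> < h (fst p - fst \<theta>)}) * indicator {0..} (snd \<theta>)"
      unfolding L_def by (simp add: nn_integral_multc)
  qed
  finally show ?thesis .
qed

section \<open>Optimality of comonotone couplings\<close>

abbreviation unit_interval :: "real measure" where
  "unit_interval \<equiv> restrict_space lborel {0<..<1}"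

lemma prob_space_unit_interval: "prob_space unit_interval"
  by (auto simp: space_restrict_space emeasure_restrict_space intro!: prob_spaceI)

lemma borel_measurable_mono_on_unit_interval:
  fixes X :: "real \<Rightarrow> real"
  shows "mono_on {0<..<1} X \<Longrightarrow> X \<in> borel_measurable unit_interval"
  using borel_measurable_mono_on_fnc[of "{0<..<1}" X]
  by (simp cong: measurable_cong_sets add: sets_restrict_space_cong[OF sets_lborel])

text \<open>
  The events \<open>{Y < s}\<close> and \<open>{X \<in> U}\<close> are an initial and a final segment of \<open>(0,1)\<close>. Either they are
  disjoint, or they cover \<open>(0,1)\<close> and then their intersection has mass \<open>P(Y < s) + P(X \<in> U) - 1\<close>,
  which is the least value that the two marginals allow.
\<close>

lemma comonotone_minimizes_quadrant:
  fixes X Y :: "real \<Rightarrow> real"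
  assumes XY: "mono_on {0<..<1} X" "mono_on {0<..<1} Y"
    and \<gamma>: "\<gamma> \<in> couplings (distr unit_interval borel X) (distr unit_interval borel Y)"
    and U: "U \<in> sets borel" "\<And>x y. x \<in> U \<Longrightarrow> x \<le> y \<Longrightarrow> y \<in> U"
  shows "emeasure unit_interval ({u\<in>{0<..<1}. Y u < s} \<inter> {u\<in>{0<..<1}. X u \<in> U})
    \<le> emeasure \<gamma> ({p. snd p < s} \<inter> {p. fst p \<in> U})"
proof -
  let ?A = "{u\<in>{0<..<1}. Y u < s}" and ?B = "{u\<in>{0<..<1}. X u \<in> U}"
  let ?A' = "{p :: real \<times> real. snd p < s}" and ?B' = "{p :: real \<times> real. fst p \<in> U}"
  interpret L: prob_space unit_interval by (rule prob_space_unit_interval)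
  interpret G: prob_space \<gamma> using \<gamma> by (simp add: couplings_def)
  have sets: "sets \<gamma> = sets borel" using \<gamma> by (simp add: couplings_def)
  have [measurable_cong]: "sets \<gamma> = sets (borel \<Otimes>\<^sub>M borel)"
    using sets by (simp only: borel_prod)
  have space: "space \<gamma> = UNIV"
    using sets_eq_imp_space_eq[OF sets] by simp
  have sp: "space unit_interval = {0<..<1}" by (simp add: space_restrict_space)
  note U(1)[measurable]
  have [measurable]: "X \<in> borel_measurable unit_interval" "Y \<in> borel_measurable unit_interval"
    by (intro borel_measurable_mono_on_unit_interval XY)+
  have A: "?A \<in> sets unit_interval"
    using measurable_sets[of Y unit_interval borel "{..<s}"]
    by (simp add: sp vimage_def Int_def conj_commute)
  have B: "?B \<in> sets unit_interval"
    using measurable_sets[of X unit_interval borel U]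
    by (simp add: sp vimage_def Int_def conj_commute)
  have A': "?A' \<in> sets \<gamma>"
    using measurable_sets[of snd \<gamma> borel "{..<s}"] by (simp add: space vimage_def)
  have B': "?B' \<in> sets \<gamma>"
    using measurable_sets[of fst \<gamma> borel U] by (simp add: space vimage_def)
  have mA: "measure \<gamma> ?A' = measure unit_interval ?A"
  proof -
    have "measure (distr \<gamma> borel snd) {..<s} = measure (distr unit_interval borel Y) {..<s}"
      using \<gamma> by (simp add: couplings_def)
    then show ?thesis
      by (simp add: measure_distr space sp vimage_def Int_def conj_commute)
  qed
  have mB: "measure \<gamma> ?B' = measure unit_interval ?B"
  proof -
    have "measure (distr \<gamma> borel fst) U = measure (distr unit_interval borel X) U"
      using \<gamma> by (simp add: couplings_def)
    then show ?thesis
      by (simp add: measure_distr space sp vimage_def Int_def conj_commute)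
  qed
  have "measure unit_interval (?A \<inter> ?B) \<le> measure \<gamma> (?A' \<inter> ?B')"
  proof (cases "?A \<inter> ?B = {}")
    case True
    then show ?thesis by simp
  next
    case False
    then obtain u where u: "u \<in> {0<..<1}" "Y u < s" "X u \<in> U" by auto
    have "v \<in> ?A \<union> ?B" if "v \<in> {0<..<1}" for v
    proof (cases "v \<le> u")
      case True
      then show ?thesis using mono_onD[OF XY(2) that u(1)] u that by auto
    next
      case False
      then show ?thesis using mono_onD[OF XY(1) u(1) that] U(2)[of "X u" "X v"] u that by auto
    qed
    then have "?A \<union> ?B = space unit_interval" unfolding sp by blast
    then have "measure unit_interval (?A \<union> ?B) = 1" by (simp only: L.prob_space)
    then have "measure unit_interval (?A \<inter> ?B) = measure \<gamma> ?A' + measure \<gamma> ?B' - 1"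
      using measure_Un3[of ?A unit_interval ?B] A B by (simp add: mA mB L.emeasure_eq_measure fmeasurableI)
    also have "\<dots> \<le> measure \<gamma> (?A' \<inter> ?B')"
      using measure_Un3[of ?A' \<gamma> ?B'] A' B' G.prob_le_1[of "?A' \<union> ?B'"]
      by (simp add: G.emeasure_eq_measure fmeasurableI)
    finally show ?thesis .
  qed
  then show ?thesis
    by (simp add: L.emeasure_eq_measure G.emeasure_eq_measure)
qed

lemma distr_pair_in_couplings:
  fixes X Y :: "'a \<Rightarrow> real"
  assumes "prob_space M" and [measurable]: "X \<in> borel_measurable M" "Y \<in> borel_measurable M"
  shows "distr M borel (\<lambda>u. (X u, Y u)) \<in> couplings (distr M borel X) (distr M borel Y)"
proof -
  have m: "(\<lambda>u. (X u, Y u)) \<in> measurable M borel"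
    unfolding borel_prod[symmetric] by measurable
  then show ?thesis
    using prob_space.prob_space_distr[OF assms(1) m]
    by (simp add: couplings_def distr_distr o_def borel_measurable_continuous_onI continuous_on_fst continuous_on_snd)
qed

text \<open>
  Both sides are superpositions, with the same weights, of the masses of the same products of a lower
  and an upper set, so they can be compared layer by layer.
\<close>

lemma comonotone_minimizes_positive_part_cost:
  fixes X Y g :: "real \<Rightarrow> real"
  assumes g: "convex_on UNIV g" "\<And>x. g 0 \<le> g x" "g 0 = 0"
    and XY: "mono_on {0<..<1} X" "mono_on {0<..<1} Y"
    and \<gamma>: "\<gamma> \<in> couplings (distr unit_interval borel X) (distr unit_interval borel Y)"
  shows "(\<integral>\<^sup>+ u. ennreal (g (max 0 (X u - Y u))) \<partial>unit_interval)
    \<le> (\<integral>\<^sup>+ p. ennreal (g (max 0 (fst p - snd p))) \<partial>\<gamma>)"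
proof -
  obtain h where h: "\<And>x y. g x + h x * (y - x) \<le> g y"
    using convex_subgradient[OF g(1)] by blast
  note mono = subgradient_mono[OF h]
  have [measurable]: "h \<in> borel_measurable borel"
    by (intro borel_measurable_mono mono)
  have [measurable]: "g \<in> borel_measurable borel"
    by (intro borel_measurable_continuous_onI convex_on_continuous g(1)) simp
  note XY[THEN borel_measurable_mono_on_unit_interval, measurable]
  have [measurable]: "(\<lambda>u. (X u, Y u)) \<in> measurable unit_interval borel"
    unfolding borel_prod[symmetric] by measurable
  \<comment> \<open>the comonotone coupling itself\<close>
  define \<gamma>0 where "\<gamma>0 = distr unit_interval borel (\<lambda>u. (X u, Y u))"
  have \<gamma>0: "prob_space \<gamma>0" "sets \<gamma>0 = sets borel"
    using distr_pair_in_couplings[OF prob_space_unit_interval, of X Y]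
    by (simp_all add: couplings_def \<gamma>0_def)
  have \<gamma>': "prob_space \<gamma>" "sets \<gamma> = sets borel"
    using \<gamma> by (simp_all add: couplings_def)
  have "(\<lambda>p :: real \<times> real. g (max 0 (fst p - snd p))) \<in> borel_measurable borel"
    unfolding borel_prod[symmetric] by measurable
  then have "(\<integral>\<^sup>+ u. ennreal (g (max 0 (X u - Y u))) \<partial>unit_interval) =
      (\<integral>\<^sup>+ p. ennreal (g (max 0 (fst p - snd p))) \<partial>\<gamma>0)"
    unfolding \<gamma>0_def by (subst nn_integral_distr) simp_all
  also have "\<dots> \<le> (\<integral>\<^sup>+ p. ennreal (g (max 0 (fst p - snd p))) \<partial>\<gamma>)"
    unfolding nn_integral_layers[OF h g(2,3) \<gamma>0] nn_integral_layers[OF h g(2,3) \<gamma>']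
  proof (intro nn_integral_mono mult_right_mono)
    fix \<theta> :: "real \<times> real"
    obtain s r where \<theta>: "\<theta> = (s, r)" by (cases \<theta>)
    define U where "U = {x. s < x \<and> r < h (x - s)}"
    have "{x \<in> space borel. s < x \<and> r < h (x - s)} \<in> sets borel"
      by measurable
    then have U: "U \<in> sets borel"
      by (simp add: U_def)
    have up: "y \<in> U" if "x \<in> U" "x \<le> y" for x y
      using that monoD[OF mono, of "x - s" "y - s"] by (auto simp: U_def)
    have "{p \<in> space (borel \<Otimes>\<^sub>M borel). snd p < s \<and> fst p \<in> U} \<in> sets (borel \<Otimes>\<^sub>M borel)"
      using U by measurable
    then have "{p. snd p < s} \<inter> {p. fst p \<in> U} \<in> sets (borel :: (real \<times> real) measure)"
      unfolding borel_prod by (simp add: Int_def)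
    then have "emeasure \<gamma>0 ({p. snd p < s} \<inter> {p. fst p \<in> U}) =
      emeasure unit_interval ({u\<in>{0<..<1}. Y u < s} \<inter> {u\<in>{0<..<1}. X u \<in> U})"
      unfolding \<gamma>0_def
      by (subst emeasure_distr) (auto simp: space_restrict_space intro!: arg_cong2[where f = emeasure])
    also have "\<dots> \<le> emeasure \<gamma> ({p. snd p < s} \<inter> {p. fst p \<in> U})"
      by (rule comonotone_minimizes_quadrant[OF XY \<gamma> U up])
    finally show "emeasure \<gamma>0 ({p. snd p < fst \<theta>} \<inter> {p. fst \<theta> < fst p \<and> snd \<theta> < h (fst p - fst \<theta>)})
      \<le> emeasure \<gamma> ({p. snd p < fst \<theta>} \<inter> {p. fst \<theta> < fst p \<and> snd \<theta> < h (fst p - fst \<theta>)})"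
      by (simp add: \<theta> U_def)
  qed simp
  finally show ?thesis .
qed

lemma swap_in_couplings:
  assumes "\<gamma> \<in> couplings M N"
  shows "distr \<gamma> borel prod.swap \<in> couplings N M"
proof -
  have s: "sets \<gamma> = sets (borel \<Otimes>\<^sub>M borel)"
    using assms unfolding borel_prod by (simp add: couplings_def)
  note [measurable_cong] = s
  have "(\<lambda>p. (snd p, fst p)) \<in> measurable \<gamma> borel"
    unfolding borel_prod[symmetric] by measurable
  then have m: "prod.swap \<in> measurable \<gamma> borel"
    by (simp add: prod.swap_def[abs_def])
  show ?thesis
    using assms m prob_space.prob_space_distr[OF _ m]
    by (simp add: couplings_def distr_distr o_def borel_measurable_continuous_onI continuous_on_fst continuous_on_snd)
qed

text \<open>
  As \<open>g 0 = 0\<close>, the cost is the sum of its parts for \<open>y < x\<close> and for \<open>x < y\<close>. The second part is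
  the first one for the reflected function and the swapped coupling.
\<close>

lemma comonotone_minimizes_cost:
  fixes X Y g :: "real \<Rightarrow> real"
  assumes g: "convex_on UNIV g" "\<And>x. g 0 \<le> g x" "g 0 = 0"
    and XY: "mono_on {0<..<1} X" "mono_on {0<..<1} Y"
    and \<gamma>: "\<gamma> \<in> couplings (distr unit_interval borel X) (distr unit_interval borel Y)"
  shows "(\<integral>\<^sup>+ u. ennreal (g (X u - Y u)) \<partial>unit_interval) \<le> (\<integral>\<^sup>+ p. ennreal (g (fst p - snd p)) \<partial>\<gamma>)"
proof -
  define g' where "g' z = g (- z)" for z
  have "convex_on UNIV g'"
  proof (rule convex_onI)
    fix t x y :: real assume "0 < t" "t < 1"
    then show "g' ((1 - t) *\<^sub>R x + t *\<^sub>R y) \<le> (1 - t) * g' x + t * g' y"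
      using convex_onD[OF g(1), of t "- x" "- y"] by (simp add: g'_def algebra_simps)
  qed simp
  moreover have "g' 0 \<le> g' x" "g' 0 = 0" for x
    using g(2)[of "- x"] g(3) by (simp_all add: g'_def)
  ultimately have g': "convex_on UNIV g'" "\<And>x. g' 0 \<le> g' x" "g' 0 = 0"
    by blast+
  have [measurable]: "g \<in> borel_measurable borel" "g' \<in> borel_measurable borel"
    by (intro borel_measurable_continuous_onI convex_on_continuous g(1) g'(1); simp)+
  have split: "ennreal (g (x - y)) = ennreal (g (max 0 (x - y))) + ennreal (g' (max 0 (y - x)))" for x y
    using g(3) g'(3) by (cases "x \<le> y") (auto simp: g'_def max_def)
  have s: "sets \<gamma> = sets (borel \<Otimes>\<^sub>M borel)"
    using \<gamma> unfolding borel_prod by (simp add: couplings_def)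
  note [measurable_cong] = s
  have "(\<lambda>p. (snd p, fst p)) \<in> measurable \<gamma> borel"
    unfolding borel_prod[symmetric] by measurable
  then have [measurable]: "prod.swap \<in> measurable \<gamma> borel"
    by (simp add: prod.swap_def[abs_def])
  note XY[THEN borel_measurable_mono_on_unit_interval, measurable]
  have "(\<lambda>p :: real \<times> real. g' (max 0 (fst p - snd p))) \<in> borel_measurable borel"
    unfolding borel_prod[symmetric] by measurable
  then have swap: "(\<integral>\<^sup>+ p. ennreal (g' (max 0 (fst p - snd p))) \<partial>distr \<gamma> borel prod.swap) =
      (\<integral>\<^sup>+ p. ennreal (g' (max 0 (snd p - fst p))) \<partial>\<gamma>)"
    by (subst nn_integral_distr) simp_all
  have "(\<integral>\<^sup>+ u. ennreal (g (X u - Y u)) \<partial>unit_interval) =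
      (\<integral>\<^sup>+ u. ennreal (g (max 0 (X u - Y u))) \<partial>unit_interval) +
      (\<integral>\<^sup>+ u. ennreal (g' (max 0 (Y u - X u))) \<partial>unit_interval)"
    unfolding split by (rule nn_integral_add) measurable
  also have "\<dots> \<le> (\<integral>\<^sup>+ p. ennreal (g (max 0 (fst p - snd p))) \<partial>\<gamma>) +
      (\<integral>\<^sup>+ p. ennreal (g' (max 0 (snd p - fst p))) \<partial>\<gamma>)"
    unfolding swap[symmetric]
    by (intro add_mono comonotone_minimizes_positive_part_cost g g' XY \<gamma> swap_in_couplings)
  also have "\<dots> = (\<integral>\<^sup>+ p. ennreal (g (fst p - snd p)) \<partial>\<gamma>)"
    unfolding split by (rule nn_integral_add[symmetric]) measurable
  finally show ?thesis .
qed

section \<open>Quantile functions and transportation cost\<close>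

text \<open>
  The left-continuous and the right-continuous distribution function have the same generalized
  inverse, since \<open>cdf M x \<le> left_cdf M z\<close> whenever \<open>x < z\<close>. This gives access to the facts on
  \<open>Inf {x. y \<le> cdf M x}\<close> behind Skorohod's theorem.
\<close>

lemma quantile_eq_Inf_cdf:
  assumes "real_distribution M" "0 < y" "y < 1"
  shows "quantile M y = Inf {x. y \<le> cdf M x}"
proof -
  interpret cdf_distribution M
    using assms(1) by (simp add: cdf_distribution_def)
  have le: "left_cdf M x \<le> cdf M x" for x
    unfolding left_cdf_def cdf_def by (intro finite_measure_mono) auto
  have ge: "cdf M x \<le> left_cdf M z" if "x < z" for x z
    unfolding left_cdf_def cdf_def using that by (intro finite_measure_mono) auto
  show ?thesis
    unfolding quantile_def
  proof (rule cInf_eq)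
    fix x assume "x \<in> {x. y \<le> left_cdf M x}"
    then show "I y \<le> x"
      using le[of x] assms by (simp flip: pseudoinverse)
  next
    fix z assume z: "\<And>x. x \<in> {x. y \<le> left_cdf M x} \<Longrightarrow> z \<le> x"
    show "z \<le> I y"
    proof (rule dense_ge)
      fix x assume "I y < x"
      then have "y \<le> left_cdf M x"
        using ge[of "I y" x] pseudoinverse[of y "I y"] assms by simp
      then show "z \<le> x" using z by simp
    qed
  qed
qed

lemma mono_on_quantile:
  assumes "real_distribution M"
  shows "mono_on {0<..<1} (quantile M)"
proof -
  interpret cdf_distribution M
    using assms by (simp add: cdf_distribution_def)
  show ?thesis
    using mono_I quantile_eq_Inf_cdf[OF assms] by (simp add: mono_on_def)
qed

lemma distr_quantile:
  assumes "real_distribution M"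
  shows "distr unit_interval borel (quantile M) = M"
proof -
  interpret cdf_distribution M
    using assms by (simp add: cdf_distribution_def)
  have "distr unit_interval borel (quantile M) = distr unit_interval borel I"
    using quantile_eq_Inf_cdf[OF assms] by (intro distr_cong) (auto simp: space_restrict_space)
  then show ?thesis
    using distr_I_eq_M by simp
qed

lemma transport_cost_ge_quantile_integral:
  fixes g :: "real \<Rightarrow> real"
  assumes g: "convex_on UNIV g" "\<And>x. g 0 \<le> g x" "g 0 = 0"
    and M: "real_distribution M" and N: "real_distribution N"
  shows "(\<integral>\<^sup>+ u. ennreal (g (quantile M u - quantile N u)) \<partial>unit_interval) \<le> transport_cost g M N"
  unfolding transport_cost_def
proof (rule INF_greatest)
  fix \<gamma> assume "\<gamma> \<in> couplings M N"
  then have "\<gamma> \<in> couplings (distr unit_interval borel (quantile M)) (distr unit_interval borel (quantile N))"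
    using M N by (simp add: distr_quantile)
  from comonotone_minimizes_cost[OF g mono_on_quantile[OF M] mono_on_quantile[OF N] this]
  show "(\<integral>\<^sup>+ u. ennreal (g (quantile M u - quantile N u)) \<partial>unit_interval)
    \<le> (\<integral>\<^sup>+ (x, y). ennreal (g (x - y)) \<partial>\<gamma>)"
    by (simp add: case_prod_beta')
qed

text \<open>
  The pair \<open>(quantile M, f)\<close> defines one particular coupling of \<open>M\<close> and the law of \<open>f\<close>.
\<close>

lemma transport_cost_le_integral:
  fixes g :: "real \<Rightarrow> real"
  assumes [measurable]: "g \<in> borel_measurable borel" "f \<in> borel_measurable unit_interval"
    and M: "real_distribution M"
  shows "transport_cost g M (distr unit_interval borel f) \<le>
    (\<integral>\<^sup>+ u. ennreal (g (quantile M u - f u)) \<partial>unit_interval)"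
proof -
  have [measurable]: "quantile M \<in> borel_measurable unit_interval"
    by (intro borel_measurable_mono_on_unit_interval mono_on_quantile M)
  have [measurable]: "(\<lambda>u. (quantile M u, f u)) \<in> measurable unit_interval borel"
    unfolding borel_prod[symmetric] by measurable
  let ?\<gamma> = "distr unit_interval borel (\<lambda>u. (quantile M u, f u))"
  have "?\<gamma> \<in> couplings M (distr unit_interval borel f)"
    using distr_pair_in_couplings[OF prob_space_unit_interval, of "quantile M" f]
    by (simp add: distr_quantile[OF M])
  then have "transport_cost g M (distr unit_interval borel f) \<le> (\<integral>\<^sup>+ (x, y). ennreal (g (x - y)) \<partial>?\<gamma>)"
    unfolding transport_cost_def by (rule INF_lower)
  moreover have "(\<lambda>(x, y). ennreal (g (x - y))) \<in> borel_measurable borel"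
    unfolding borel_prod[symmetric] by measurable
  ultimately show ?thesis
    by (simp add: nn_integral_distr)
qed

section \<open>The barycenter\<close>

context
  fixes g :: "real \<Rightarrow> real" and n :: nat and \<mu> :: "nat \<Rightarrow> real measure" and w :: "nat \<Rightarrow> real"
  assumes g: "strictly_convex_on UNIV g" "\<And>x. g 0 \<le> g x" "g 0 = 0"
    and n: "1 \<le> n"
    and \<mu>: "\<And>i. i \<in> {1..n} \<Longrightarrow> real_distribution (\<mu> i)"
    and w: "\<And>i. i \<in> {1..n} \<Longrightarrow> 0 < w i"
begin

private lemma g_convex: "convex_on UNIV g"
  by (rule strictly_convex_imp_convex_on[OF g(1)])

private lemma g_measurable: "g \<in> borel_measurable borel"
  by (intro borel_measurable_continuous_onI convex_on_continuous g_convex) simp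

private lemma g_nonneg: "0 \<le> g x"
  using g(2)[of x] g(3) by simp

private lemma w_nonneg: "i \<in> {1..n} \<Longrightarrow> 0 \<le> w i"
  using w[of i] by simp

private abbreviation (input) "\<Phi> \<equiv> quantile_cost g n \<mu> w"
private abbreviation (input) "\<psi> \<equiv> quantile_argmin g n \<mu> w"

lemma strictly_convex_quantile_cost: "strictly_convex_on UNIV (\<Phi> x)"
  unfolding strictly_convex_on_def
proof (intro conjI ballI allI impI)
  fix y z t :: real assume yz: "y \<noteq> z" and t: "0 < t" "t < 1"
  have "\<Phi> x ((1 - t) * y + t * z) <
      (\<Sum>i=1..n. w i * ((1 - t) * g (quantile (\<mu> i) x - y) + t * g (quantile (\<mu> i) x - z)))"
    unfolding quantile_cost_def
  proof (rule sum_strict_mono)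
    fix i assume i: "i \<in> {1..n}"
    let ?q = "quantile (\<mu> i) x"
    have "g ((1 - t) * (?q - y) + t * (?q - z)) < (1 - t) * g (?q - y) + t * g (?q - z)"
      using g(1) yz t by (simp add: strictly_convex_on_def)
    moreover have "(1 - t) * (?q - y) + t * (?q - z) = ?q - ((1 - t) * y + t * z)"
      by (simp add: algebra_simps)
    ultimately show "w i * g (?q - ((1 - t) * y + t * z)) < w i * ((1 - t) * g (?q - y) + t * g (?q - z))"
      using w[OF i] by simp
  qed (use n in auto)
  also have "\<dots> = (1 - t) * \<Phi> x y + t * \<Phi> x z"
    by (simp add: quantile_cost_def sum_distrib_left sum.distrib[symmetric] algebra_simps)
  finally show "\<Phi> x ((1 - t) * y + t * z) < (1 - t) * \<Phi> x y + t * \<Phi> x z" .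
qed simp

text \<open>
  The first summand alone is coercive and the others are nonnegative, so the sublevel set of \<open>\<Phi> x 0\<close>
  is compact.
\<close>

lemma quantile_cost_minimizer_exists: "\<exists>y. is_arg_min (\<Phi> x) (\<lambda>_. True) y"
proof -
  obtain c where c: "0 < c" "\<And>z. 1 \<le> \<bar>z\<bar> \<Longrightarrow> c * \<bar>z\<bar> \<le> g z"
    using strictly_convex_linear_growth[OF g] by blast
  define q where "q = quantile (\<mu> 1) x"
  \<comment> \<open>beyond distance \<open>R\<close> from \<open>q\<close>, linear growth makes the first summand exceed \<open>\<Phi> x 0\<close>\<close>
  define R where "R = max 1 (\<Phi> x 0 / (w 1 * c))"
  define K where "K = {y. \<Phi> x y \<le> \<Phi> x 0}"
  have w1: "0 < w 1" using w n by simp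
  have cont: "continuous_on UNIV (\<Phi> x)"
    by (intro convex_on_continuous strictly_convex_imp_convex_on strictly_convex_quantile_cost) simp
  have "K \<subseteq> cball q R"
  proof
    fix y assume "y \<in> K"
    have "w 1 * g (q - y) \<le> \<Phi> x y"
      unfolding quantile_cost_def q_def
      by (rule member_le_sum) (use n w g_nonneg in \<open>auto intro!: mult_nonneg_nonneg[OF less_imp_le]\<close>)
    with \<open>y \<in> K\<close> have le: "w 1 * g (q - y) \<le> \<Phi> x 0"
      by (simp add: K_def)
    have "\<bar>q - y\<bar> \<le> R"
    proof (cases "1 \<le> \<bar>q - y\<bar>")
      case True
      have "w 1 * (c * \<bar>q - y\<bar>) \<le> \<Phi> x 0"
        using mult_left_mono[OF c(2)[OF True], of "w 1"] w1 le by linarith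
      then have "\<bar>q - y\<bar> \<le> \<Phi> x 0 / (w 1 * c)"
        using w1 c(1) by (simp add: pos_le_divide_eq mult_ac)
      then show ?thesis by (simp add: R_def)
    qed (simp add: R_def)
    then show "y \<in> cball q R" by (simp add: dist_real_def)
  qed
  moreover have "closed K"
    unfolding K_def by (intro closed_Collect_le cont continuous_on_const)
  ultimately have "compact K"
    using bounded_subset[OF bounded_cball] compact_eq_bounded_closed by blast
  moreover have "K \<noteq> {}" by (auto simp: K_def)
  ultimately obtain y where y: "y \<in> K" "\<forall>z\<in>K. \<Phi> x y \<le> \<Phi> x z"
    using continuous_attains_inf[of K "\<Phi> x"] continuous_on_subset[OF cont] by blast
  have "\<Phi> x y \<le> \<Phi> x z" for z
    using y by (cases "z \<in> K") (auto simp: K_def)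
  then show ?thesis
    by (auto simp: is_arg_min_linorder)
qed

lemma quantile_cost_unique_minimizer: "\<exists>!y. is_arg_min (\<Phi> x) (\<lambda>_. True) y"
  using quantile_cost_minimizer_exists strictly_convex_unique_minimizer[OF strictly_convex_quantile_cost]
  by blast

lemma quantile_argmin_is_arg_min: "is_arg_min (\<Phi> x) (\<lambda>_. True) (\<psi> x)"
  unfolding quantile_argmin_def arg_min_def
  by (rule someI_ex[OF quantile_cost_minimizer_exists])

lemma quantile_argmin_le: "\<Phi> x (\<psi> x) \<le> \<Phi> x y"
  using quantile_argmin_is_arg_min by (simp add: is_arg_min_linorder)

lemma quantile_argmin_unique:
  assumes "\<Phi> x y \<le> \<Phi> x (\<psi> x)"
  shows "y = \<psi> x"
proof -
  have "is_arg_min (\<Phi> x) (\<lambda>_. True) y"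
    using order_trans[OF assms quantile_argmin_le] by (simp add: is_arg_min_linorder)
  then show ?thesis
    by (rule strictly_convex_unique_minimizer[OF strictly_convex_quantile_cost _ quantile_argmin_is_arg_min])
qed

text \<open>
  If \<open>\<psi> b < \<psi> a\<close> for some \<open>a \<le> b\<close>, then by \<open>convex_increment_mono\<close> moving from \<open>\<psi> a\<close> down to
  \<open>\<psi> b\<close> raises \<open>\<Phi> a\<close> by at most as much as \<open>\<Phi> b\<close>. It does not raise \<open>\<Phi> b\<close>, whose minimum is at
  \<open>\<psi> b\<close>; so \<open>\<psi> b\<close> would also minimize \<open>\<Phi> a\<close>, against uniqueness.
\<close>

lemma mono_on_quantile_argmin: "mono_on {0<..<1} \<psi>"
proof (rule mono_onI, rule ccontr)
  fix a b :: real
  assume ab: "a \<in> {0<..<1}" "b \<in> {0<..<1}" "a \<le> b" and less: "\<not> \<psi> a \<le> \<psi> b"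
  define s where "s = \<psi> a - \<psi> b"
  have "\<Phi> a (\<psi> b) - \<Phi> a (\<psi> a) \<le> \<Phi> b (\<psi> b) - \<Phi> b (\<psi> a)"
    unfolding quantile_cost_def sum_subtractf[symmetric]
  proof (rule sum_mono)
    fix i assume i: "i \<in> {1..n}"
    let ?a = "quantile (\<mu> i) a - \<psi> a" and ?b = "quantile (\<mu> i) b - \<psi> a"
    have "g (?a + s) - g ?a \<le> g (?b + s) - g ?b"
      using mono_onD[OF mono_on_quantile[OF \<mu>[OF i]] ab] less
      by (intro convex_increment_mono g_convex) (auto simp: s_def)
    then have "w i * (g (?a + s) - g ?a) \<le> w i * (g (?b + s) - g ?b)"
      using w[OF i] by simp
    then show "w i * g (quantile (\<mu> i) a - \<psi> b) - w i * g ?a \<le> w i * g (quantile (\<mu> i) b - \<psi> b) - w i * g ?b"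
      by (simp add: s_def right_diff_distrib)
  qed
  then have "\<Phi> a (\<psi> b) \<le> \<Phi> a (\<psi> a)"
    using quantile_argmin_le[of b "\<psi> a"] by linarith
  from quantile_argmin_unique[OF this] less show False by simp
qed

lemma quantile_argmin_measurable: "\<psi> \<in> borel_measurable unit_interval"
  by (intro borel_measurable_mono_on_unit_interval mono_on_quantile_argmin)

lemma quantile_measurable: "i \<in> {1..n} \<Longrightarrow> quantile (\<mu> i) \<in> borel_measurable unit_interval"
  by (intro borel_measurable_mono_on_unit_interval mono_on_quantile \<mu>)

lemma quantile_cost_nonneg: "0 \<le> \<Phi> x y"
  unfolding quantile_cost_def by (intro sum_nonneg mult_nonneg_nonneg g_nonneg w_nonneg)

lemma quantile_cost_measurable:
  assumes [measurable]: "f \<in> borel_measurable unit_interval"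
  shows "(\<lambda>u. \<Phi> u (f u)) \<in> borel_measurable unit_interval"
  unfolding quantile_cost_def
proof (rule borel_measurable_sum)
  fix i assume "i \<in> {1..n}"
  note g_measurable[measurable] quantile_measurable[OF this, measurable]
  show "(\<lambda>u. w i * g (quantile (\<mu> i) u - f u)) \<in> borel_measurable unit_interval" by measurable
qed

lemma nn_integral_quantile_cost:
  assumes f[measurable]: "f \<in> borel_measurable unit_interval"
  shows "(\<integral>\<^sup>+ u. ennreal (\<Phi> u (f u)) \<partial>unit_interval) =
    (\<Sum>i=1..n. ennreal (w i) * (\<integral>\<^sup>+ u. ennreal (g (quantile (\<mu> i) u - f u)) \<partial>unit_interval))"
proof -
  have "(\<integral>\<^sup>+ u. ennreal (\<Phi> u (f u)) \<partial>unit_interval) =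
      (\<integral>\<^sup>+ u. (\<Sum>i=1..n. ennreal (w i) * ennreal (g (quantile (\<mu> i) u - f u))) \<partial>unit_interval)"
  proof (rule nn_integral_cong)
    fix u :: real
    have "(\<Sum>i=1..n. ennreal (w i) * ennreal (g (quantile (\<mu> i) u - f u))) =
        (\<Sum>i=1..n. ennreal (w i * g (quantile (\<mu> i) u - f u)))"
      using w_nonneg by (intro sum.cong) (simp_all add: ennreal_mult')
    also have "\<dots> = ennreal (\<Phi> u (f u))"
      unfolding quantile_cost_def
      by (intro sum_ennreal mult_nonneg_nonneg g_nonneg w_nonneg)
    finally show "ennreal (\<Phi> u (f u)) = (\<Sum>i=1..n. ennreal (w i) * ennreal (g (quantile (\<mu> i) u - f u)))" ..
  qed
  also have "\<dots> = (\<Sum>i=1..n. (\<integral>\<^sup>+ u. ennreal (w i) * ennreal (g (quantile (\<mu> i) u - f u)) \<partial>unit_interval))"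
  proof (rule nn_integral_sum)
    fix i assume "i \<in> {1..n}"
    note g_measurable[measurable] quantile_measurable[OF this, measurable]
    show "(\<lambda>u. ennreal (w i) * ennreal (g (quantile (\<mu> i) u - f u))) \<in> borel_measurable unit_interval"
      by measurable
  qed
  also have "\<dots> = (\<Sum>i=1..n. ennreal (w i) * (\<integral>\<^sup>+ u. ennreal (g (quantile (\<mu> i) u - f u)) \<partial>unit_interval))"
  proof (rule sum.cong[OF refl])
    fix i assume "i \<in> {1..n}"
    note g_measurable[measurable] quantile_measurable[OF this, measurable]
    show "(\<integral>\<^sup>+ u. ennreal (w i) * ennreal (g (quantile (\<mu> i) u - f u)) \<partial>unit_interval) =
      ennreal (w i) * (\<integral>\<^sup>+ u. ennreal (g (quantile (\<mu> i) u - f u)) \<partial>unit_interval)"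
      by (rule nn_integral_cmult) measurable
  qed
  finally show ?thesis .
qed

lemma frechet_functional_ge:
  assumes \<nu>: "real_distribution \<nu>"
  shows "(\<integral>\<^sup>+ u. ennreal (\<Phi> u (quantile \<nu> u)) \<partial>unit_interval) \<le> frechet_functional g n \<mu> w \<nu>"
  unfolding frechet_functional_def
    nn_integral_quantile_cost[OF borel_measurable_mono_on_unit_interval[OF mono_on_quantile[OF \<nu>]]]
  by (intro sum_mono mult_left_mono transport_cost_ge_quantile_integral g_convex g \<mu> \<nu>) simp_all

lemma frechet_functional_distr_le:
  assumes f: "f \<in> borel_measurable unit_interval"
  shows "frechet_functional g n \<mu> w (distr unit_interval borel f) \<le>
    (\<integral>\<^sup>+ u. ennreal (\<Phi> u (f u)) \<partial>unit_interval)"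
  unfolding frechet_functional_def nn_integral_quantile_cost[OF f]
  by (intro sum_mono mult_left_mono transport_cost_le_integral g_measurable f \<mu>) simp_all

lemma frechet_functional_lower_bound:
  assumes "real_distribution \<nu>"
  shows "(\<integral>\<^sup>+ u. ennreal (\<Phi> u (\<psi> u)) \<partial>unit_interval) \<le> frechet_functional g n \<mu> w \<nu>"
proof -
  have "(\<integral>\<^sup>+ u. ennreal (\<Phi> u (\<psi> u)) \<partial>unit_interval) \<le>
      (\<integral>\<^sup>+ u. ennreal (\<Phi> u (quantile \<nu> u)) \<partial>unit_interval)"
    by (intro nn_integral_mono ennreal_leI quantile_argmin_le)
  also have "\<dots> \<le> frechet_functional g n \<mu> w \<nu>"
    by (rule frechet_functional_ge[OF assms])
  finally show ?thesis .
qed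

lemma real_distribution_distr_argmin: "real_distribution (distr unit_interval borel \<psi>)"
  using prob_space.real_distribution_distr[OF prob_space_unit_interval quantile_argmin_measurable] .

lemma distr_argmin_is_barycenter:
  "is_frechet_barycenter g n \<mu> w (distr unit_interval borel \<psi>)"
  unfolding is_frechet_barycenter_def is_arg_min_linorder
  by (intro conjI allI impI real_distribution_distr_argmin
      order_trans[OF frechet_functional_distr_le[OF quantile_argmin_measurable] frechet_functional_lower_bound])

text \<open>
  For a minimizer \<open>\<nu>\<close> the integral of \<open>\<Phi> u (quantile \<nu> u) \<ge> \<Phi> u (\<psi> u)\<close> is at most that of
  \<open>\<Phi> u (\<psi> u)\<close>. The measure \<open>\<rho>\<close> of finite cost makes the latter finite, so the integrands agree
  almost everywhere.
\<close>

lemma barycenter_unique: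
  assumes fin: "real_distribution \<rho>" "frechet_functional g n \<mu> w \<rho> < \<infinity>"
    and \<nu>: "is_frechet_barycenter g n \<mu> w \<nu>"
  shows "\<nu> = distr unit_interval borel \<psi>"
proof -
  have rd: "real_distribution \<nu>"
    using \<nu> by (simp add: is_frechet_barycenter_def is_arg_min_def)
  have q: "quantile \<nu> \<in> borel_measurable unit_interval"
    by (intro borel_measurable_mono_on_unit_interval mono_on_quantile rd)
  have minimal: "frechet_functional g n \<mu> w \<nu> \<le> frechet_functional g n \<mu> w \<sigma>" if "real_distribution \<sigma>" for \<sigma>
    using \<nu> that by (simp add: is_frechet_barycenter_def is_arg_min_linorder)
  let ?A = "\<lambda>u. ennreal (\<Phi> u (quantile \<nu> u))" and ?B = "\<lambda>u. ennreal (\<Phi> u (\<psi> u))"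
  have meas: "?A \<in> borel_measurable unit_interval" "?B \<in> borel_measurable unit_interval"
    using quantile_cost_measurable[OF q] quantile_cost_measurable[OF quantile_argmin_measurable] by measurable
  have "integral\<^sup>N unit_interval ?A \<le> frechet_functional g n \<mu> w \<nu>"
    by (rule frechet_functional_ge[OF rd])
  also have "\<dots> \<le> frechet_functional g n \<mu> w (distr unit_interval borel \<psi>)"
    by (rule minimal[OF real_distribution_distr_argmin])
  also have "\<dots> \<le> integral\<^sup>N unit_interval ?B"
    by (rule frechet_functional_distr_le[OF quantile_argmin_measurable])
  finally have le: "integral\<^sup>N unit_interval ?A \<le> integral\<^sup>N unit_interval ?B" .
  have finB: "integral\<^sup>N unit_interval ?B \<noteq> \<infinity>"
    using frechet_functional_lower_bound[OF fin(1)] fin(2) by auto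
  have "(\<integral>\<^sup>+ u. ?A u - ?B u \<partial>unit_interval) = integral\<^sup>N unit_interval ?A - integral\<^sup>N unit_interval ?B"
    using meas finB by (intro nn_integral_diff AE_I2 ennreal_leI quantile_argmin_le) auto
  also have "\<dots> = 0"
    by (rule diff_eq_0_ennreal[OF le_less_trans[OF le] le]) (use finB in \<open>simp add: less_top\<close>)
  finally have "AE u in unit_interval. ?A u - ?B u = 0"
    by (subst (asm) nn_integral_0_iff_AE) (rule borel_measurable_minus_ennreal[OF meas])
  then have "AE u in unit_interval. quantile \<nu> u = \<psi> u"
  proof (rule AE_mp, intro AE_I2 impI)
    fix u assume "?A u - ?B u = 0"
    then have "\<Phi> u (quantile \<nu> u) \<le> \<Phi> u (\<psi> u)"
      using quantile_cost_nonneg by (simp add: ennreal_minus ennreal_eq_0_iff)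
    then show "quantile \<nu> u = \<psi> u"
      by (rule quantile_argmin_unique)
  qed
  then have "distr unit_interval borel (quantile \<nu>) = distr unit_interval borel \<psi>"
    by (intro distr_cong_AE refl q quantile_argmin_measurable)
  then show ?thesis
    by (simp add: distr_quantile[OF rd])
qed

end

theorem theorem1:
  fixes g :: "real \<Rightarrow> real"
    and n :: nat
    and \<mu> :: "nat \<Rightarrow> real measure"
    and w :: "nat \<Rightarrow> real"
  assumes "strictly_convex_on UNIV g"
    and "\<forall>x. g 0 \<le> g x"
    and "g 0 = 0"
    and "1 \<le> n"
    and "\<forall>i\<in>{1..n}. real_distribution (\<mu> i)"
    and "\<forall>i\<in>{1..n}. 0 < w i"
    and "\<exists>\<nu>. real_distribution \<nu> \<and> frechet_functional g n \<mu> w \<nu> < \<infinity>"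
  shows "(\<exists>!\<nu>. is_frechet_barycenter g n \<mu> w \<nu>) \<and>
    (\<forall>x\<in>{0<..<1}. \<exists>!y. is_arg_min (quantile_cost g n \<mu> w x) (\<lambda>_. True) y) \<and>
    quantile_argmin g n \<mu> w \<in> borel_measurable (restrict_space lborel {0<..<1}) \<and>
    is_frechet_barycenter g n \<mu> w
      (distr (restrict_space lborel {0<..<1}) borel (quantile_argmin g n \<mu> w))"
proof -
  have g: "g 0 \<le> g x" for x using assms(2) by blast
  have \<mu>: "real_distribution (\<mu> i)" if "i \<in> {1..n}" for i using assms(5) that by blast
  have w: "0 < w i" if "i \<in> {1..n}" for i using assms(6) that by blast
  note hyps = assms(1) g assms(3,4) \<mu> w
  obtain \<rho> where \<rho>: "real_distribution \<rho>" "frechet_functional g n \<mu> w \<rho> < \<infinity>"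
    using assms(7) by blast
  have bary: "is_frechet_barycenter g n \<mu> w (distr unit_interval borel (quantile_argmin g n \<mu> w))"
    by (rule distr_argmin_is_barycenter[OF hyps])
  have "\<exists>!\<nu>. is_frechet_barycenter g n \<mu> w \<nu>"
    using bary barycenter_unique[OF hyps \<rho>] by blast
  then show ?thesis
    by (intro conjI ballI bary quantile_cost_unique_minimizer[OF hyps] quantile_argmin_measurable[OF hyps])
qed

end
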